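(* Let $M=(S,T,I,L)$ be a Kripke structure and $\psi$ an LTL formula in positive normal form. Then $M$ has an initialised infinite path $\pi$ such that $\pi\models\psi$ if and only if there exists $k\in\mathbb{N}$ such that the Büchi encoding $[\![M,\psi,k]\!]$ is satisfiable. In particular, if $\pi$ is an initialised infinite path of $M$ with $\pi\models_k\psi$, then $[\![M,\psi,k]\!]$ is satisfiable.
   Context: Kripke structures: $AP$ is a set of atomic propositions; $M=(S,T,I,L)$ has a finite set of states $S$ (valuations of finitely many Boolean state variables), total transition relation $T\subseteq S\times S$, initial states $I$, labelling $L:S\to2^{AP}$. An infinite path $\pi=s_0s_1\ldots$ is initialised if $s_0\in I$. LTL in positive normal form: built from $p,\neg p$ ($p\in AP$) with $\wedge,\vee,\mathbf{X},\mathbf{U},\mathbf{R}$ with standard semantics ($\pi^i\models\psi_1\mathbf{U}\psi_2$ iff $\exists j\ge i$: $\pi^j\models\psi_2$ and $\pi^n\models\psi_1$ for $i\le n<j$; $\pi^i\models\psi_1\mathbf{R}\psi_2$ iff $\forall j\ge i$: $\pi^j\models\psi_2$ or $\pi^n\models\psi_1$ for some $i\le n<j$; $\pi^i\models\mathbf{X}\psi_1$ iff $\pi^{i+1}\models\psi_1$). $\mathit{cl}(\psi)$: set of subformulas. Bounded semantics: $\pi$ is a $(k,l)$-loop if $\pi=(s_0\ldots s_{l-1})(s_l\ldots s_k)^\omega$ with $0<l\le k$, $s_{l-1}=s_k$. $\pi\models_k\psi$ iff (a) $\pi$ is a $(k,l)$-loop for some $0<l\le k$ and $\pi^0\models\psi$,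 or (b) $\pi^0\models^{nl}_k\psi$, where $\models^{nl}_k$ agrees with $\models$ on $p,\neg p,\wedge,\vee$ and: $\pi^i\models^{nl}_k\mathbf{X}\psi_1$ iff $i<k$ and $\pi^{i+1}\models^{nl}_k\psi_1$; $\pi^i\models^{nl}_k\psi_1\mathbf{U}\psi_2$ iff $\exists i\le j\le k$: $\pi^j\models^{nl}_k\psi_2$ and $\pi^n\models^{nl}_k\psi_1$ for $i\le n<j$; $\pi^i\models^{nl}_k\psi_1\mathbf{R}\psi_2$ iff $\exists i\le j\le k$: $\pi^j\models^{nl}_k\psi_1$ and $\pi^n\models^{nl}_k\psi_2$ for $i\le n\le j$. Encoding. Propositional copies $s_0..s_k$ of state variables; $[\![M]\!]_k=I(s_0)\wedge\bigwedge_{i=1}^kT(s_{i-1},s_i)$. Loop constraints (fresh $l_0..l_k$, $\mathit{InLoop}_0..\mathit{InLoop}_k$, $\mathit{LoopExists}$): $l_0\Leftrightarrow\bot$, $\mathit{InLoop}_0\Leftrightarrow\bot$; for $1\le i\le k$: $l_i\Rightarrow(s_{i-1}=s_k)$, $\mathit{InLoop}_i\Leftrightarrow\mathit{InLoop}_{i-1}\vee l_i$, $\mathit{InLoop}_{i-1}\Rightarrow\neg l_i$; $\mathit{LoopExists}\Leftrightarrow\mathit{InLoop}_k$. Fresh variables $[\![\varphi]\!]_i$ for $\varphi\in\mathit{cl}(\psi)$, $0\le i\le k+1$, with: for $0\le i\le k$, $[\![p]\!]_i\Leftrightarrow(p\in L(s_i))$, $[\![\neg p]\!]_i\Leftrightarrow(p\notin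 L(s_i))$, $[\![\psi_1\wedge\psi_2]\!]_i\Leftrightarrow[\![\psi_1]\!]_i\wedge[\![\psi_2]\!]_i$, $[\![\psi_1\vee\psi_2]\!]_i\Leftrightarrow[\![\psi_1]\!]_i\vee[\![\psi_2]\!]_i$, $[\![\mathbf{X}\psi_1]\!]_i\Leftrightarrow[\![\psi_1]\!]_{i+1}$, $[\![\psi_1\mathbf{U}\psi_2]\!]_i\Leftrightarrow[\![\psi_2]\!]_i\vee([\![\psi_1]\!]_i\wedge[\![\psi_1\mathbf{U}\psi_2]\!]_{i+1})$, $[\![\psi_1\mathbf{R}\psi_2]\!]_i\Leftrightarrow[\![\psi_2]\!]_i\wedge([\![\psi_1]\!]_i\vee[\![\psi_1\mathbf{R}\psi_2]\!]_{i+1})$. Last-state constraints for each $\varphi\in\mathit{cl}(\psi)$: $\neg\mathit{LoopExists}\Rightarrow([\![\varphi]\!]_{k+1}\Leftrightarrow\bot)$, and $l_i\Rightarrow([\![\varphi]\!]_{k+1}\Leftrightarrow[\![\varphi]\!]_i)$ for $1\le i\le k$. Büchi acceptance constraints: for each subformula $\varphi=\psi_1\mathbf{U}\psi_2$, fresh $\langle\!\langle Acc(\varphi)\rangle\!\rangle_i$ ($0\le i\le k$) with $\langle\!\langle Acc(\varphi)\rangle\!\rangle_0\Leftrightarrow\bot$, $\mathit{LoopExists}\Rightarrow\langle\!\langle Acc(\varphi)\rangle\!\rangle_k$, and for $1\le i\le k$: $\langle\!\langle Acc(\varphi)\rangle\!\rangle_i\Leftrightarrow\langle\!\langle Acc(\varphi)\rangle\!\rangle_{i-1}\vee(\mathit{InLoop}_i\wedge([\![\psi_2]\!]_i\vee\neg[\![\varphi]\!]_i))$;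 for each subformula $\varphi=\psi_1\mathbf{R}\psi_2$, the same with the last constraint replaced by $\langle\!\langle Acc(\varphi)\rangle\!\rangle_i\Leftrightarrow\langle\!\langle Acc(\varphi)\rangle\!\rangle_{i-1}\vee(\mathit{InLoop}_i\wedge(\neg[\![\psi_2]\!]_i\vee[\![\varphi]\!]_i))$. The Büchi encoding $[\![M,\psi,k]\!]$ is the conjunction of the model constraints, loop constraints, last-state constraints, the formula-variable and Büchi acceptance constraints, and $[\![\psi]\!]_0$. *)

theory Defs
  imports "HOL-Library.Omega_Words_Fun"
begin

section \<open>Kripke structures and paths\<close>

text \<open>
  A state is a valuation of the state variables, represented by the set of those variables
  that it makes true. The set of states may be any set of such valuations. The type
  \<open>'p\<close> plays the role of the set of atomic propositions.
\<close>

record ('v, 'p) kripke =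
  Vars :: "'v set"
  States :: "'v set set"
  Trans :: "('v set \<times> 'v set) set"
  Init :: "'v set set"
  Label :: "'v set \<Rightarrow> 'p set"

definition kripke_structure :: "('v, 'p) kripke \<Rightarrow> bool" where
  "kripke_structure M \<longleftrightarrow>
     finite (Vars M) \<and> States M \<subseteq> Pow (Vars M) \<and>
     Init M \<subseteq> States M \<and> Trans M \<subseteq> States M \<times> States M \<and>
     (\<forall>s\<in>States M. \<exists>t\<in>States M. (s, t) \<in> Trans M)"

definition initialised_path :: "('v, 'p) kripke \<Rightarrow> 'v set word \<Rightarrow> bool" where
  "initialised_path M \<pi> \<longleftrightarrow> \<pi> 0 \<in> Init M \<and> (\<forall>i. (\<pi> i, \<pi> (Suc i)) \<in> Trans M)"


section \<open>LTL in positive normal form\<close>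

datatype 'p ltl =
    Prop 'p
  | NProp 'p
  | And "'p ltl" "'p ltl"
  | Or "'p ltl" "'p ltl"
  | Next "'p ltl"
  | Until "'p ltl" "'p ltl"
  | Release "'p ltl" "'p ltl"

primrec cl :: "'p ltl \<Rightarrow> 'p ltl set" where
  "cl (Prop p) = {Prop p}"
| "cl (NProp p) = {NProp p}"
| "cl (And a b) = insert (And a b) (cl a \<union> cl b)"
| "cl (Or a b) = insert (Or a b) (cl a \<union> cl b)"
| "cl (Next a) = insert (Next a) (cl a)"
| "cl (Until a b) = insert (Until a b) (cl a \<union> cl b)"
| "cl (Release a b) = insert (Release a b) (cl a \<union> cl b)"

lemma finite_cl: "finite (cl \<psi>)"
  by (induction \<psi>) auto

text \<open>\<open>models L \<pi> i \<phi>\<close> says that the suffix of \<open>\<pi>\<close> from position \<open>i\<close> satisfies \<open>\<phi>\<close>.\<close>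

primrec models :: "('s \<Rightarrow> 'p set) \<Rightarrow> 's word \<Rightarrow> nat \<Rightarrow> 'p ltl \<Rightarrow> bool" where
  "models L \<pi> i (Prop p) \<longleftrightarrow> p \<in> L (\<pi> i)"
| "models L \<pi> i (NProp p) \<longleftrightarrow> p \<notin> L (\<pi> i)"
| "models L \<pi> i (And a b) \<longleftrightarrow> models L \<pi> i a \<and> models L \<pi> i b"
| "models L \<pi> i (Or a b) \<longleftrightarrow> models L \<pi> i a \<or> models L \<pi> i b"
| "models L \<pi> i (Next a) \<longleftrightarrow> models L \<pi> (i + 1) a"
| "models L \<pi> i (Until a b) \<longleftrightarrow>
     (\<exists>j\<ge>i. models L \<pi> j b \<and> (\<forall>n. i \<le> n \<and> n < j \<longrightarrow> models L \<pi> n a))"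
| "models L \<pi> i (Release a b) \<longleftrightarrow>
     (\<forall>j\<ge>i. models L \<pi> j b \<or> (\<exists>n. i \<le> n \<and> n < j \<and> models L \<pi> n a))"


section \<open>Bounded semantics\<close>

definition kl_loop :: "'s word \<Rightarrow> nat \<Rightarrow> nat \<Rightarrow> bool" where
  "kl_loop \<pi> k l \<longleftrightarrow>
     0 < l \<and> l \<le> k \<and> \<pi> = \<pi> [0 \<rightarrow> l] \<frown> (\<pi> [l \<rightarrow> k + 1])\<^sup>\<omega> \<and> \<pi> (l - 1) = \<pi> k"

primrec models_nl :: "('s \<Rightarrow> 'p set) \<Rightarrow> nat \<Rightarrow> 's word \<Rightarrow> nat \<Rightarrow> 'p ltl \<Rightarrow> bool" where
  "models_nl L k \<pi> i (Prop p) \<longleftrightarrow> p \<in> L (\<pi> i)"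
| "models_nl L k \<pi> i (NProp p) \<longleftrightarrow> p \<notin> L (\<pi> i)"
| "models_nl L k \<pi> i (And a b) \<longleftrightarrow> models_nl L k \<pi> i a \<and> models_nl L k \<pi> i b"
| "models_nl L k \<pi> i (Or a b) \<longleftrightarrow> models_nl L k \<pi> i a \<or> models_nl L k \<pi> i b"
| "models_nl L k \<pi> i (Next a) \<longleftrightarrow> i < k \<and> models_nl L k \<pi> (i + 1) a"
| "models_nl L k \<pi> i (Until a b) \<longleftrightarrow>
     (\<exists>j. i \<le> j \<and> j \<le> k \<and> models_nl L k \<pi> j b \<and>
          (\<forall>n. i \<le> n \<and> n < j \<longrightarrow> models_nl L k \<pi> n a))"
| "models_nl L k \<pi> i (Release a b) \<longleftrightarrow>
     (\<exists>j. i \<le> j \<and> j \<le> k \<and> models_nl L k \<pi> j a \<and>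
          (\<forall>n. i \<le> n \<and> n \<le> j \<longrightarrow> models_nl L k \<pi> n b))"

definition models_bounded :: "('s \<Rightarrow> 'p set) \<Rightarrow> nat \<Rightarrow> 's word \<Rightarrow> 'p ltl \<Rightarrow> bool" where
  "models_bounded L k \<pi> \<psi> \<longleftrightarrow>
     ((\<exists>l. 0 < l \<and> l \<le> k \<and> kl_loop \<pi> k l) \<and> models L \<pi> 0 \<psi>) \<or> models_nl L k \<pi> 0 \<psi>"


section \<open>Propositional formulas\<close>

datatype 'x pform =
    PTop
  | PBot
  | PVar 'x
  | PNot "'x pform"
  | PAnd "'x pform" "'x pform"
  | POr "'x pform" "'x pform"
  | PImp "'x pform" "'x pform"
  | PIff "'x pform" "'x pform"

primrec peval :: "('x \<Rightarrow> bool) \<Rightarrow> 'x pform \<Rightarrow> bool" where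
  "peval v PTop \<longleftrightarrow> True"
| "peval v PBot \<longleftrightarrow> False"
| "peval v (PVar x) \<longleftrightarrow> v x"
| "peval v (PNot a) \<longleftrightarrow> \<not> peval v a"
| "peval v (PAnd a b) \<longleftrightarrow> peval v a \<and> peval v b"
| "peval v (POr a b) \<longleftrightarrow> peval v a \<or> peval v b"
| "peval v (PImp a b) \<longleftrightarrow> (peval v a \<longrightarrow> peval v b)"
| "peval v (PIff a b) \<longleftrightarrow> (peval v a \<longleftrightarrow> peval v b)"

definition satisfiable :: "'x pform \<Rightarrow> bool" where
  "satisfiable f \<longleftrightarrow> (\<exists>v. peval v f)"

text \<open>
  Conjunctions and disjunctions indexed by a finite set. The order of the members is fixed by an
  arbitrary enumeration; it is irrelevant up to equivalence, as the two lemmas below show.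
\<close>

definition enum_of :: "'a set \<Rightarrow> 'a list" where
  "enum_of A = (SOME xs. set xs = A)"

definition PAll :: "'a set \<Rightarrow> ('a \<Rightarrow> 'x pform) \<Rightarrow> 'x pform" where
  "PAll A f = foldr PAnd (map f (enum_of A)) PTop"

definition PEx :: "'a set \<Rightarrow> ('a \<Rightarrow> 'x pform) \<Rightarrow> 'x pform" where
  "PEx A f = foldr POr (map f (enum_of A)) PBot"

lemma set_enum_of: "finite A \<Longrightarrow> set (enum_of A) = A"
  unfolding enum_of_def by (rule someI_ex) (rule finite_list)

lemma peval_PAll: "finite A \<Longrightarrow> peval v (PAll A f) \<longleftrightarrow> (\<forall>a\<in>A. peval v (f a))"
proof -
  assume "finite A"
  moreover have "peval v (foldr PAnd (map f xs) PTop) \<longleftrightarrow> (\<forall>a\<in>set xs. peval v (f a))" for xs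
    by (induction xs) auto
  ultimately show ?thesis by (simp add: PAll_def set_enum_of)
qed

lemma peval_PEx: "finite A \<Longrightarrow> peval v (PEx A f) \<longleftrightarrow> (\<exists>a\<in>A. peval v (f a))"
proof -
  assume "finite A"
  moreover have "peval v (foldr POr (map f xs) PBot) \<longleftrightarrow> (\<exists>a\<in>set xs. peval v (f a))" for xs
    by (induction xs) auto
  ultimately show ?thesis by (simp add: PEx_def set_enum_of)
qed


section \<open>The Buchi encoding\<close>

text \<open>
  \<open>StateVar x i\<close> is the copy of the state variable \<open>x\<close> at time \<open>i\<close>; \<open>FVar \<phi> i\<close> is
  the variable for the truth of \<open>\<phi>\<close> at time \<open>i\<close> (up to time \<open>k + 1\<close>), and \<open>AccVar \<phi> i\<close>, for \<open>\<phi>\<close> an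
  Until or Release formula, records that the acceptance condition of \<open>\<phi>\<close> has been met in the
  loop by time \<open>i\<close>.
\<close>

datatype ('v, 'p) enc_var =
    StateVar 'v nat
  | LVar nat
  | InLoop nat
  | LoopExists
  | FVar "'p ltl" nat
  | AccVar "'p ltl" nat

type_synonym ('v, 'p) enc_form = "('v, 'p) enc_var pform"

text \<open>
  The characteristic formulas over the copies of the state variables, standing for
  membership in \<open>Init\<close>, \<open>Trans\<close> and \<open>Label\<close>, are taken in disjunctive normal form. Here \<open>state_is M i s\<close> says that the
  \<open>i\<close>-th copy of the state variables takes the value \<open>s\<close>.
\<close>

definition state_is :: "('v, 'p) kripke \<Rightarrow> nat \<Rightarrow> 'v set \<Rightarrow> ('v, 'p) enc_form" where
  "state_is M i s =
     PAll (Vars M) (\<lambda>x. if x \<in> s then PVar (StateVar x i) else PNot (PVar (StateVar x i)))"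

definition init_form :: "('v, 'p) kripke \<Rightarrow> nat \<Rightarrow> ('v, 'p) enc_form" where
  "init_form M i = PEx (Init M) (state_is M i)"

definition trans_form :: "('v, 'p) kripke \<Rightarrow> nat \<Rightarrow> nat \<Rightarrow> ('v, 'p) enc_form" where
  "trans_form M i j = PEx (Trans M) (\<lambda>(s, t). PAnd (state_is M i s) (state_is M j t))"

definition label_form :: "('v, 'p) kripke \<Rightarrow> 'p \<Rightarrow> nat \<Rightarrow> ('v, 'p) enc_form" where
  "label_form M p i = PEx {s \<in> States M. p \<in> Label M s} (state_is M i)"

definition state_eq_form :: "('v, 'p) kripke \<Rightarrow> nat \<Rightarrow> nat \<Rightarrow> ('v, 'p) enc_form" where
  "state_eq_form M i j = PAll (Vars M) (\<lambda>x. PIff (PVar (StateVar x i)) (PVar (StateVar x j)))"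

definition model_constraints :: "('v, 'p) kripke \<Rightarrow> nat \<Rightarrow> ('v, 'p) enc_form" where
  "model_constraints M k = PAnd (init_form M 0) (PAll {1..k} (\<lambda>i. trans_form M (i - 1) i))"

definition loop_constraints :: "('v, 'p) kripke \<Rightarrow> nat \<Rightarrow> ('v, 'p) enc_form" where
  "loop_constraints M k =
     PAnd (PIff (PVar (LVar 0)) PBot)
    (PAnd (PIff (PVar (InLoop 0)) PBot)
    (PAnd (PAll {1..k} (\<lambda>i.
             PAnd (PImp (PVar (LVar i)) (state_eq_form M (i - 1) k))
            (PAnd (PIff (PVar (InLoop i)) (POr (PVar (InLoop (i - 1))) (PVar (LVar i))))
                  (PImp (PVar (InLoop (i - 1))) (PNot (PVar (LVar i)))))))
          (PIff (PVar LoopExists) (PVar (InLoop k)))))"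

primrec formula_def :: "('v, 'p) kripke \<Rightarrow> nat \<Rightarrow> 'p ltl \<Rightarrow> ('v, 'p) enc_form" where
  "formula_def M i (Prop p) = label_form M p i"
| "formula_def M i (NProp p) = PNot (label_form M p i)"
| "formula_def M i (And a b) = PAnd (PVar (FVar a i)) (PVar (FVar b i))"
| "formula_def M i (Or a b) = POr (PVar (FVar a i)) (PVar (FVar b i))"
| "formula_def M i (Next a) = PVar (FVar a (i + 1))"
| "formula_def M i (Until a b) =
     POr (PVar (FVar b i)) (PAnd (PVar (FVar a i)) (PVar (FVar (Until a b) (i + 1))))"
| "formula_def M i (Release a b) =
     PAnd (PVar (FVar b i)) (POr (PVar (FVar a i)) (PVar (FVar (Release a b) (i + 1))))"

definition formula_constraints :: "('v, 'p) kripke \<Rightarrow> 'p ltl \<Rightarrow> nat \<Rightarrow> ('v, 'p) enc_form" where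
  "formula_constraints M \<psi> k =
     PAll (cl \<psi>) (\<lambda>\<phi>. PAll {0..k} (\<lambda>i. PIff (PVar (FVar \<phi> i)) (formula_def M i \<phi>)))"

definition last_state_constraints :: "'p ltl \<Rightarrow> nat \<Rightarrow> ('v, 'p) enc_form" where
  "last_state_constraints \<psi> k =
     PAll (cl \<psi>) (\<lambda>\<phi>.
       PAnd (PImp (PNot (PVar LoopExists)) (PIff (PVar (FVar \<phi> (k + 1))) PBot))
            (PAll {1..k} (\<lambda>i.
               PImp (PVar (LVar i)) (PIff (PVar (FVar \<phi> (k + 1))) (PVar (FVar \<phi> i))))))"

text \<open>
  \<open>acc_form \<phi> k C\<close> collects the acceptance constraints for \<open>\<phi>\<close>, where \<open>C i\<close> is the condition
  that has to hold at some position \<open>i\<close> of the loop.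
\<close>

definition acc_form ::
  "'p ltl \<Rightarrow> nat \<Rightarrow> (nat \<Rightarrow> ('v, 'p) enc_form) \<Rightarrow> ('v, 'p) enc_form" where
  "acc_form \<phi> k C =
     PAnd (PIff (PVar (AccVar \<phi> 0)) PBot)
    (PAnd (PImp (PVar LoopExists) (PVar (AccVar \<phi> k)))
          (PAll {1..k} (\<lambda>i.
             PIff (PVar (AccVar \<phi> i))
                  (POr (PVar (AccVar \<phi> (i - 1))) (PAnd (PVar (InLoop i)) (C i))))))"

definition acceptance_constraints :: "'p ltl \<Rightarrow> nat \<Rightarrow> ('v, 'p) enc_form" where
  "acceptance_constraints \<psi> k =
     PAll (cl \<psi>) (\<lambda>\<phi>. case \<phi> of
         Until a b \<Rightarrow> acc_form \<phi> k (\<lambda>i. POr (PVar (FVar b i)) (PNot (PVar (FVar \<phi> i))))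
       | Release a b \<Rightarrow> acc_form \<phi> k (\<lambda>i. POr (PNot (PVar (FVar b i))) (PVar (FVar \<phi> i)))
       | _ \<Rightarrow> PTop)"

definition buchi_encoding :: "('v, 'p) kripke \<Rightarrow> 'p ltl \<Rightarrow> nat \<Rightarrow> ('v, 'p) enc_form" where
  "buchi_encoding M \<psi> k =
     PAnd (model_constraints M k)
    (PAnd (loop_constraints M k)
    (PAnd (last_state_constraints \<psi> k)
    (PAnd (formula_constraints M \<psi> k)
    (PAnd (acceptance_constraints \<psi> k)
          (PVar (FVar \<psi> 0))))))"

end

theory Submission
  imports Defs
begin

text \<open>
  A satisfying valuation with a loop starting at \<open>l\<close> is unwound along the lasso of period
  \<open>k + 1 - l\<close>: the formula variables then satisfy the one-step expansion laws at every position,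
  and the acceptance constraints exclude an Until that is postponed forever. Without a loop,
  all formula variables are false beyond \<open>k\<close> and any extension of the finite path works.

  Conversely, the truth values of the subformulas along a path satisfy the constraints as soon as
  positions \<open>l - 1\<close> and \<open>k\<close> carry the same state and satisfy the same subformulas one step later;
  since only finitely many such combinations exist, one of them recurs infinitely often, so \<open>k\<close>
  can be taken beyond all acceptance witnesses. The bounded semantics without a loop satisfies
  the constraints with the loop start placed at the unreachable position \<open>k + 1\<close>.
\<close>

section \<open>Expansion laws\<close>

lemma cl_refl: "\<phi> \<in> cl \<phi>"
  by (cases \<phi>) auto

lemma cl_subset: "\<phi> \<in> cl \<psi> \<Longrightarrow> cl \<phi> \<subseteq> cl \<psi>"
  by (induction \<psi>) auto

text \<open>
  \<open>N\<close> and \<open>X\<close> are the formulas held true now and in the next position, and \<open>A\<close> is the current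
  label.
\<close>

primrec expand :: "'p set \<Rightarrow> ('p ltl \<Rightarrow> bool) \<Rightarrow> ('p ltl \<Rightarrow> bool) \<Rightarrow> 'p ltl \<Rightarrow> bool" where
  "expand A N X (Prop p) \<longleftrightarrow> p \<in> A"
| "expand A N X (NProp p) \<longleftrightarrow> p \<notin> A"
| "expand A N X (And a b) \<longleftrightarrow> N a \<and> N b"
| "expand A N X (Or a b) \<longleftrightarrow> N a \<or> N b"
| "expand A N X (Next a) \<longleftrightarrow> X a"
| "expand A N X (Until a b) \<longleftrightarrow> N b \<or> (N a \<and> X (Until a b))"
| "expand A N X (Release a b) \<longleftrightarrow> N b \<and> (N a \<or> X (Release a b))"

text \<open>The Buchi condition attached to a fixpoint formula: an Until is fulfilled or no longer
  pending, and dually for Release. All other formulas accept trivially, so that acceptance can be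
  asked of all of \<open>cl \<psi>\<close> uniformly.\<close>

definition accepts :: "('p ltl \<Rightarrow> bool) \<Rightarrow> 'p ltl \<Rightarrow> bool" where
  "accepts N \<phi> \<longleftrightarrow>
     (case \<phi> of Until a b \<Rightarrow> N b \<or> \<not> N \<phi> | Release a b \<Rightarrow> \<not> N b \<or> N \<phi> | _ \<Rightarrow> True)"

text \<open>One unfolding consults the next position only at a direct subformula or at
  \<open>\<phi>\<close> itself. Hence it is enough to know the next values on the closure, which is
  where the last-state constraints fix them.\<close>

lemma expand_cong:
  assumes "\<And>\<chi>. \<chi> \<in> cl \<phi> \<Longrightarrow> X \<chi> = X' \<chi>"
  shows "expand A N X \<phi> = expand A N X' \<phi>"
  using assms by (cases \<phi>) (auto simp: cl_refl)

lemma ex_ge_unfold: "(\<exists>j\<ge>i. P j) \<longleftrightarrow> P i \<or> (\<exists>j\<ge>Suc i. P j)" for i :: nat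
  by (metis Suc_leD le_antisym not_less_eq_eq order_refl)

lemma models_expand:
  "models L \<pi> i \<phi> \<longleftrightarrow> expand (L (\<pi> i)) (models L \<pi> i) (models L \<pi> (Suc i)) \<phi>"
proof (cases \<phi>)
  case (Until a b)
  have "(\<forall>n. i \<le> n \<and> n < j \<longrightarrow> models L \<pi> n a) \<longleftrightarrow>
      models L \<pi> i a \<and> (\<forall>n. Suc i \<le> n \<and> n < j \<longrightarrow> models L \<pi> n a)" if "Suc i \<le> j" for j
    using that by (metis Suc_le_eq le_eq_less_or_eq)
  then have "(\<exists>j\<ge>Suc i. models L \<pi> j b \<and> (\<forall>n. i \<le> n \<and> n < j \<longrightarrow> models L \<pi> n a)) \<longleftrightarrow>
      models L \<pi> i a \<and> models L \<pi> (Suc i) (Until a b)"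
    unfolding models.simps by blast
  then show ?thesis
    unfolding Until by (subst models.simps, subst ex_ge_unfold) auto
next
  case (Release a b)
  have "(\<exists>n. i \<le> n \<and> n < j \<and> models L \<pi> n a) \<longleftrightarrow>
      models L \<pi> i a \<or> (\<exists>n. Suc i \<le> n \<and> n < j \<and> models L \<pi> n a)" if "Suc i \<le> j" for j
    using that by (metis Suc_le_eq le_eq_less_or_eq)
  moreover have "(\<forall>j\<ge>i. P j) \<longleftrightarrow> P i \<and> (\<forall>j\<ge>Suc i. P j)" for P
    using ex_ge_unfold[of i "\<lambda>j. \<not> P j"] by blast
  ultimately show ?thesis
    unfolding Release by (subst models.simps) auto
qed auto

text \<open>If everything counts as false beyond \<open>k\<close>, the existential bounded Release
  obeys the same unfolding law as the unbounded one: at \<open>k\<close> both sides demand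
  \<open>a\<close> and \<open>b\<close> together.\<close>

lemma models_nl_expand:
  assumes "i \<le> k"
  shows "models_nl L k \<pi> i \<phi> \<longleftrightarrow>
    expand (L (\<pi> i)) (models_nl L k \<pi> i) (\<lambda>\<chi>. Suc i \<le> k \<and> models_nl L k \<pi> (Suc i) \<chi>) \<phi>"
proof (cases \<phi>)
  case (Until a b)
  have "(\<forall>n. i \<le> n \<and> n < j \<longrightarrow> models_nl L k \<pi> n a) \<longleftrightarrow>
      models_nl L k \<pi> i a \<and> (\<forall>n. Suc i \<le> n \<and> n < j \<longrightarrow> models_nl L k \<pi> n a)"
    if "Suc i \<le> j" for j
    using that by (metis Suc_le_eq le_eq_less_or_eq)
  then have "(\<exists>j\<ge>Suc i. j \<le> k \<and> models_nl L k \<pi> j b \<and>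
        (\<forall>n. i \<le> n \<and> n < j \<longrightarrow> models_nl L k \<pi> n a)) \<longleftrightarrow>
      models_nl L k \<pi> i a \<and> Suc i \<le> k \<and> models_nl L k \<pi> (Suc i) (Until a b)"
    unfolding models_nl.simps by (meson order.trans)
  then show ?thesis
    using assms unfolding Until by (subst models_nl.simps, subst ex_ge_unfold) auto
next
  case (Release a b)
  have "(\<forall>n. i \<le> n \<and> n \<le> j \<longrightarrow> models_nl L k \<pi> n b) \<longleftrightarrow>
      models_nl L k \<pi> i b \<and> (\<forall>n. Suc i \<le> n \<and> n \<le> j \<longrightarrow> models_nl L k \<pi> n b)"
    if "Suc i \<le> j" for j
    using that by (metis Suc_le_eq Suc_leD le_eq_less_or_eq)
  then have "(\<exists>j\<ge>Suc i. j \<le> k \<and> models_nl L k \<pi> j a \<and>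
        (\<forall>n. i \<le> n \<and> n \<le> j \<longrightarrow> models_nl L k \<pi> n b)) \<longleftrightarrow>
      models_nl L k \<pi> i b \<and> Suc i \<le> k \<and> models_nl L k \<pi> (Suc i) (Release a b)"
    unfolding models_nl.simps by (meson order.trans)
  then show ?thesis
    using assms unfolding Release by (subst models_nl.simps, subst ex_ge_unfold) auto
qed auto

text \<open>A false Until or a true Release accepts at \<open>i\<close> itself. A true Until accepts
  where \<open>b\<close> holds, a false Release where \<open>b\<close> fails.\<close>

lemma ex_accepts_models: "\<exists>j\<ge>i. accepts (models L \<pi> j) \<phi>"
proof (cases \<phi>)
  case (Until a b)
  then show ?thesis
    by (cases "models L \<pi> i \<phi>") (auto simp: accepts_def)
next
  case (Release a b)
  then show ?thesis
    by (cases "models L \<pi> i \<phi>") (auto simp: accepts_def)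
qed (auto simp: accepts_def)

text \<open>In positive normal form no subformula is negated, so the implication from
  \<open>F\<close> to \<open>models\<close> passes through the induction. Acceptance bounds how long
  an Until can be postponed.\<close>

lemma expand_sound:
  assumes "\<And>\<phi> i. \<phi> \<in> cl \<psi> \<Longrightarrow> F i \<phi> \<Longrightarrow> expand (L (\<pi> i)) (F i) (F (Suc i)) \<phi>"
    and "\<And>\<phi> i. \<phi> \<in> cl \<psi> \<Longrightarrow> \<exists>j\<ge>i. accepts (F j) \<phi>"
    and "F i \<psi>"
  shows "models L \<pi> i \<psi>"
  using assms
proof (induction \<psi> arbitrary: i)
  case (Prop p)
  then show ?case using Prop.prems(1)[of "Prop p" i] by simp
next
  case (NProp p)
  then show ?case using NProp.prems(1)[of "NProp p" i] by simp
next
  case (And a b)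
  show ?case
    using And.prems(1)[of "And a b" i] And.prems(3)
      And.IH(1)[OF And.prems(1,2)] And.IH(2)[OF And.prems(1,2)] by simp
next
  case (Or a b)
  show ?case
    using Or.prems(1)[of "Or a b" i] Or.prems(3)
      Or.IH(1)[OF Or.prems(1,2)] Or.IH(2)[OF Or.prems(1,2)] by auto
next
  case (Next a)
  show ?case
    using Next.prems(1)[of "Next a" i] Next.prems(3) Next.IH[OF Next.prems(1,2)] by simp
next
  case (Until a b)
  have a: "models L \<pi> i a" if "F i a" for i
    using Until.IH(1)[OF Until.prems(1,2)] that by simp
  have b: "models L \<pi> i b" if "F i b" for i
    using Until.IH(2)[OF Until.prems(1,2)] that by simp
  have unfold: "F i b \<or> F i a \<and> F (Suc i) (Until a b)" if "F i (Until a b)" for i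
    using Until.prems(1)[of "Until a b" i] that by simp
  \<comment> \<open>The accepting position is the base of a backward induction down to
    \<open>i\<close>: a claim of the Until still pending at \<open>j\<close> forces
    \<open>F j b\<close> there.\<close>
  obtain j where "j \<ge> i" "F j b \<or> \<not> F j (Until a b)"
    using Until.prems(2)[of "Until a b" i] by (auto simp: accepts_def)
  then show ?case using Until.prems(3)
  proof (induction i rule: inc_induct)
    case base
    then show ?case using unfold[of j] b[of j] by (subst models_expand) auto
  next
    case (step i)
    then show ?case using unfold[of i] a[of i] b[of i]
      by (subst models_expand) auto
  qed
next
  case (Release a b)
  have a: "models L \<pi> i a" if "F i a" for i
    using Release.IH(1)[OF Release.prems(1,2)] that by simp
  have b: "models L \<pi> i b" if "F i b" for i
    using Release.IH(2)[OF Release.prems(1,2)] that by simp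
  have unfold: "F i b \<and> (F i a \<or> F (Suc i) (Release a b))" if "F i (Release a b)" for i
    using Release.prems(1)[of "Release a b" i] that by simp
  \<comment> \<open>Where \<open>a\<close> fails semantically, \<open>F\<close> cannot claim it, so
    the unfolding hands the Release on to the next position, up to \<open>j\<close>.\<close>
  have "models L \<pi> j b" if "j \<ge> i" "\<forall>n. i \<le> n \<and> n < j \<longrightarrow> \<not> models L \<pi> n a" for j
  proof -
    have "F j (Release a b)"
      using that
    proof (induction j rule: dec_induct)
      case base
      show ?case by (fact Release.prems(3))
    next
      case (step j)
      then show ?case using unfold[of j] a[of j] by auto
    qed
    then show ?thesis using unfold b by blast
  qed
  then show ?case by auto
qed

lemma models_suffix: "models L (suffix d \<pi>) i \<phi> \<longleftrightarrow> models L \<pi> (d + i) \<phi>"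
proof (induction \<phi> arbitrary: i)
  case (Until a b)
  have ex: "(\<exists>j\<ge>d + i. P j) \<longleftrightarrow> (\<exists>j\<ge>i. P (d + j))" for P
    by (metis add.assoc le_Suc_ex nat_add_left_cancel_le)
  have "(\<forall>n. d + i \<le> n \<and> n < d + j \<longrightarrow> P n) \<longleftrightarrow> (\<forall>n. i \<le> n \<and> n < j \<longrightarrow> P (d + n))" for j P
    using ex[of "\<lambda>n. n < d + j \<and> \<not> P n"] by auto
  then show ?case
    by (simp only: models.simps ex Until)
next
  case (Release a b)
  have ex: "(\<exists>j\<ge>d + i. P j) \<longleftrightarrow> (\<exists>j\<ge>i. P (d + j))" for P
    by (metis add.assoc le_Suc_ex nat_add_left_cancel_le)
  have "(\<forall>j\<ge>d + i. P j) \<longleftrightarrow> (\<forall>j\<ge>i. P (d + j))" for P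
    using ex[of "\<lambda>n. \<not> P n"] by blast
  moreover have "(\<exists>n. d + i \<le> n \<and> n < d + j \<and> P n) \<longleftrightarrow> (\<exists>n. i \<le> n \<and> n < j \<and> P (d + n))" for j P
    using ex[of "\<lambda>n. n < d + j \<and> P n"] by auto
  ultimately show ?case
    by (simp only: models.simps Release)
qed simp_all

lemma models_eq_if_suffix_eq:
  assumes "suffix i \<pi> = suffix j \<pi>"
  shows "models L \<pi> i \<phi> \<longleftrightarrow> models L \<pi> j \<phi>"
  using models_suffix[of L i \<pi> 0 \<phi>] models_suffix[of L j \<pi> 0 \<phi>] assms by simp

section \<open>Semantics of the encoding\<close>

text \<open>The restriction to \<open>Vars M\<close> discards copies of variables that the
  constraints never mention.\<close>

definition decode :: "('v, 'p) kripke \<Rightarrow> (('v, 'p) enc_var \<Rightarrow> bool) \<Rightarrow> nat \<Rightarrow> 'v set" where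
  "decode M v i = {x \<in> Vars M. v (StateVar x i)}"

lemma kripke_structureD:
  assumes "kripke_structure M"
  shows "finite (Vars M)" "finite (States M)" "finite (Init M)" "finite (Trans M)"
    "Init M \<subseteq> States M" "Trans M \<subseteq> States M \<times> States M" "States M \<subseteq> Pow (Vars M)"
proof -
  show *: "finite (Vars M)" "Init M \<subseteq> States M" "Trans M \<subseteq> States M \<times> States M"
    "States M \<subseteq> Pow (Vars M)"
    using assms by (auto simp: kripke_structure_def)
  then show fin: "finite (States M)"
    using finite_subset by blast
  show "finite (Init M)" "finite (Trans M)"
    using finite_subset[OF *(2) fin] finite_subset[OF *(3)] fin by auto
qed

lemma peval_state_is:
  assumes "kripke_structure M" "s \<in> States M"
  shows "peval v (state_is M i s) \<longleftrightarrow> decode M v i = s"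
proof -
  have "peval v (state_is M i s) \<longleftrightarrow> (\<forall>x\<in>Vars M. v (StateVar x i) \<longleftrightarrow> x \<in> s)"
    using kripke_structureD(1)[OF assms(1)] by (auto simp: state_is_def peval_PAll)
  moreover have "s \<subseteq> Vars M"
    using kripke_structureD(7)[OF assms(1)] assms(2) by blast
  ultimately show ?thesis by (auto simp: decode_def)
qed

lemma peval_init_form:
  assumes "kripke_structure M"
  shows "peval v (init_form M i) \<longleftrightarrow> decode M v i \<in> Init M"
  using kripke_structureD[OF assms] peval_state_is[OF assms]
  by (auto simp: init_form_def peval_PEx subset_iff)

lemma peval_trans_form:
  assumes "kripke_structure M"
  shows "peval v (trans_form M i j) \<longleftrightarrow> (decode M v i, decode M v j) \<in> Trans M"
proof -
  have "peval v (trans_form M i j) \<longleftrightarrow>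
      (\<exists>(s, t) \<in> Trans M. peval v (state_is M i s) \<and> peval v (state_is M j t))"
    using kripke_structureD[OF assms] by (auto simp: trans_form_def peval_PEx split_def)
  also have "\<dots> \<longleftrightarrow> (\<exists>(s, t) \<in> Trans M. decode M v i = s \<and> decode M v j = t)"
    using kripke_structureD(6)[OF assms] peval_state_is[OF assms]
    by (intro bex_cong) auto
  finally show ?thesis by auto
qed

lemma peval_label_form:
  assumes "kripke_structure M"
  shows "peval v (label_form M p i) \<longleftrightarrow>
    decode M v i \<in> States M \<and> p \<in> Label M (decode M v i)"
  using kripke_structureD[OF assms] peval_state_is[OF assms]
  by (auto simp: label_form_def peval_PEx)

lemma peval_state_eq_form:
  assumes "kripke_structure M"
  shows "peval v (state_eq_form M i j) \<longleftrightarrow> decode M v i = decode M v j"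
  using kripke_structureD[OF assms] by (auto simp: state_eq_form_def peval_PAll decode_def)

text \<open>\<open>label_form\<close> enumerates states only and is false elsewhere, so it agrees
  with \<open>Label M\<close> once the decoded valuation is known to be a state.\<close>

lemma peval_formula_def:
  assumes "kripke_structure M" "decode M v i \<in> States M"
  shows "peval v (formula_def M i \<phi>) \<longleftrightarrow>
    expand (Label M (decode M v i)) (\<lambda>\<chi>. v (FVar \<chi> i)) (\<lambda>\<chi>. v (FVar \<chi> (Suc i))) \<phi>"
  using assms by (cases \<phi>) (auto simp: peval_label_form)

lemma peval_model_constraints:
  assumes "kripke_structure M"
  shows "peval v (model_constraints M k) \<longleftrightarrow> decode M v 0 \<in> Init M \<and>
    (\<forall>i<k. (decode M v i, decode M v (Suc i)) \<in> Trans M)"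
proof -
  have "(\<forall>i\<in>{1..k}. P (i - 1) i) \<longleftrightarrow> (\<forall>i<k. P i (Suc i))" for P
    by (metis One_nat_def Suc_le_eq atLeastAtMost_iff diff_Suc_1 le_add1 plus_1_eq_Suc Suc_pred')
  from this[of "\<lambda>i j. (decode M v i, decode M v j) \<in> Trans M"] show ?thesis
    using assms by (simp add: model_constraints_def peval_PAll peval_init_form peval_trans_form)
qed

lemma decode_in_States:
  assumes "kripke_structure M" "peval v (model_constraints M k)" "i \<le> k"
  shows "decode M v i \<in> States M"
proof (cases i)
  case 0
  then show ?thesis
    using assms kripke_structureD(5)[OF assms(1)] by (auto simp: peval_model_constraints)
next
  case (Suc j)
  then have "(decode M v j, decode M v i) \<in> Trans M"
    using assms by (auto simp: peval_model_constraints)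
  then show ?thesis
    using kripke_structureD(6)[OF assms(1)] by auto
qed

lemma peval_loop_constraints:
  assumes "kripke_structure M"
  shows "peval v (loop_constraints M k) \<longleftrightarrow>
    \<not> v (LVar 0) \<and> \<not> v (InLoop 0) \<and>
    (\<forall>i\<in>{1..k}. (v (LVar i) \<longrightarrow> decode M v (i - 1) = decode M v k) \<and>
      (v (InLoop i) \<longleftrightarrow> v (InLoop (i - 1)) \<or> v (LVar i)) \<and>
      (v (InLoop (i - 1)) \<longrightarrow> \<not> v (LVar i))) \<and>
    (v LoopExists \<longleftrightarrow> v (InLoop k))"
  using assms by (simp add: loop_constraints_def peval_PAll peval_state_eq_form)

lemma peval_formula_constraints:
  assumes "kripke_structure M" "peval v (model_constraints M k)"
  shows "peval v (formula_constraints M \<psi> k) \<longleftrightarrow>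
    (\<forall>\<phi>\<in>cl \<psi>. \<forall>i\<le>k. v (FVar \<phi> i) \<longleftrightarrow>
      expand (Label M (decode M v i)) (\<lambda>\<chi>. v (FVar \<chi> i)) (\<lambda>\<chi>. v (FVar \<chi> (Suc i))) \<phi>)"
  using assms decode_in_States[OF assms]
  by (simp add: formula_constraints_def peval_PAll peval_formula_def finite_cl Ball_def)

lemma peval_last_state_constraints:
  "peval v (last_state_constraints \<psi> k) \<longleftrightarrow>
    (\<forall>\<phi>\<in>cl \<psi>. (\<not> v LoopExists \<longrightarrow> \<not> v (FVar \<phi> (Suc k))) \<and>
      (\<forall>i\<in>{1..k}. v (LVar i) \<longrightarrow> v (FVar \<phi> (Suc k)) = v (FVar \<phi> i)))"
  by (simp add: last_state_constraints_def peval_PAll finite_cl)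

text \<open>The common shape of the recursions for \<open>InLoop\<close> and \<open>AccVar\<close>:
  a running disjunction that starts from false.\<close>

lemma iff_ex_atLeastAtMost_if_step:
  fixes i k :: nat
  assumes "\<not> P 0" "\<And>i. i \<in> {1..k} \<Longrightarrow> P i \<longleftrightarrow> P (i - 1) \<or> Q i" "i \<le> k"
  shows "P i \<longleftrightarrow> (\<exists>j\<in>{1..i}. Q j)"
  using assms(3)
proof (induction i)
  case 0
  then show ?case using assms(1) by simp
next
  case (Suc i)
  then show ?case using assms(2)[of "Suc i"] by (auto simp: atLeastAtMostSuc_conv)
qed

lemma peval_acceptance_constraints:
  "peval v (acceptance_constraints \<psi> k) \<longleftrightarrow>
    (\<forall>\<phi>\<in>cl \<psi>. (\<exists>a b. \<phi> = Until a b \<or> \<phi> = Release a b) \<longrightarrow>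
      \<not> v (AccVar \<phi> 0) \<and> (v LoopExists \<longrightarrow> v (AccVar \<phi> k)) \<and>
      (\<forall>i\<in>{1..k}. v (AccVar \<phi> i) \<longleftrightarrow>
        v (AccVar \<phi> (i - 1)) \<or> v (InLoop i) \<and> accepts (\<lambda>\<chi>. v (FVar \<chi> i)) \<phi>))"
  unfolding acceptance_constraints_def peval_PAll[OF finite_cl]
  by (intro ball_cong refl) (auto simp: acc_form_def peval_PAll accepts_def split: ltl.split)

lemma accepts_if_not_temporal:
  "\<not> (\<exists>a b. \<phi> = Until a b \<or> \<phi> = Release a b) \<Longrightarrow> accepts N \<phi>"
  by (cases \<phi>) (auto simp: accepts_def)

section \<open>From valuations to paths\<close>

text \<open>Totality of the transition relation yields a successor function; its iterates from
  \<open>s k\<close> continue the finite path.\<close>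

lemma extend_to_path:
  assumes "kripke_structure M" "s 0 \<in> Init M" "\<And>i. i < k \<Longrightarrow> (s i, s (Suc i)) \<in> Trans M"
  obtains \<pi> where "initialised_path M \<pi>" "\<And>i. i \<le> k \<Longrightarrow> \<pi> i = s i"
proof -
  obtain f where f: "\<And>t. t \<in> States M \<Longrightarrow> f t \<in> States M \<and> (t, f t) \<in> Trans M"
    using assms(1) unfolding kripke_structure_def by metis
  have "s k \<in> States M"
    using kripke_structureD(5,6)[OF assms(1)] assms(2) assms(3)[of "k - 1"] by (cases k) auto
  then have in_States: "(f ^^ n) (s k) \<in> States M" for n
    by (induction n) (auto simp: f)
  define \<pi> where "\<pi> i = (if i \<le> k then s i else (f ^^ (i - k)) (s k))" for i
  have "(\<pi> i, \<pi> (Suc i)) \<in> Trans M" for i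
  proof (cases "i < k")
    case True
    then show ?thesis using assms(3) by (simp add: \<pi>_def)
  next
    case False
    then have "\<pi> i = (f ^^ (i - k)) (s k)" "\<pi> (Suc i) = f ((f ^^ (i - k)) (s k))"
      by (auto simp: \<pi>_def Suc_diff_le)
    then show ?thesis using f in_States by simp
  qed
  then have "initialised_path M \<pi>"
    using assms(2) by (simp add: initialised_path_def \<pi>_def)
  then show thesis
    using that[of \<pi>] by (simp add: \<pi>_def)
qed

text \<open>The position among \<open>0..k\<close> reached after \<open>i\<close> steps, for
  \<open>l \<le> k\<close>. The step after \<open>k\<close> leads to \<open>l\<close> and not to
  \<open>l - 1\<close>, because the loop closes on equal states at \<open>l - 1\<close> and
  \<open>k\<close>.\<close>

definition lasso_index :: "nat \<Rightarrow> nat \<Rightarrow> nat \<Rightarrow> nat" where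
  "lasso_index k l i = (if i < l then i else l + (i - l) mod (Suc k - l))"

lemma lasso_index_le: "l \<le> k \<Longrightarrow> lasso_index k l i \<le> k"
proof -
  assume "l \<le> k"
  then have "(i - l) mod (Suc k - l) < Suc k - l" by simp
  then have "l + (i - l) mod (Suc k - l) \<le> k" by linarith
  then show ?thesis using \<open>l \<le> k\<close> by (auto simp: lasso_index_def)
qed

lemma lasso_index_Suc:
  assumes "l \<le> k"
  shows "lasso_index k l (Suc i) = (if lasso_index k l i = k then l else Suc (lasso_index k l i))"
proof (cases "i < l")
  case True
  then show ?thesis using assms by (auto simp: lasso_index_def not_less_eq)
next
  case False
  then show ?thesis using assms by (auto simp: lasso_index_def Suc_diff_le mod_Suc)
qed

text \<open>Adding \<open>i\<close> full periods to \<open>j\<close> moves past \<open>i\<close> and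
  keeps the residue, so each loop position recurs arbitrarily late.\<close>

lemma ex_lasso_index_eq:
  assumes "l \<le> j" "j \<le> k"
  shows "\<exists>m\<ge>i. lasso_index k l m = j"
proof (intro exI conjI)
  have "i \<le> i * (Suc k - l)" using assms by (cases "Suc k - l") auto
  then show "i \<le> j + i * (Suc k - l)" by (rule trans_le_add2)
  have "j + i * (Suc k - l) - l = (j - l) + i * (Suc k - l)" using assms by simp
  then have "(j + i * (Suc k - l) - l) mod (Suc k - l) = (j - l) mod (Suc k - l)"
    by (simp only: mod_mult_self1)
  also have "\<dots> = j - l" using assms by simp
  finally show "lasso_index k l (j + i * (Suc k - l)) = j"
    unfolding lasso_index_def using assms by (simp only:) simp
qed

lemma ex_path_if_satisfiable:
  assumes "kripke_structure M" "satisfiable (buchi_encoding M \<psi> k)"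
  shows "\<exists>\<pi>. initialised_path M \<pi> \<and> models (Label M) \<pi> 0 \<psi>"
proof -
  obtain v where v: "peval v (buchi_encoding M \<psi> k)"
    using assms(2) by (auto simp: satisfiable_def)
  define s where "s = decode M v"
  have model: "peval v (model_constraints M k)"
    using v by (simp add: buchi_encoding_def)
  have s0: "s 0 \<in> Init M" and trans: "\<And>i. i < k \<Longrightarrow> (s i, s (Suc i)) \<in> Trans M"
    using model by (auto simp: peval_model_constraints[OF assms(1)] s_def)
  have loop: "peval v (loop_constraints M k)"
    using v by (simp add: buchi_encoding_def)
  have last: "peval v (last_state_constraints \<psi> k)"
    using v by (simp add: buchi_encoding_def)
  have acc: "peval v (acceptance_constraints \<psi> k)"
    using v by (simp add: buchi_encoding_def)
  have \<psi>: "v (FVar \<psi> 0)"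
    using v by (simp add: buchi_encoding_def)
  have formula: "v (FVar \<phi> i) \<longleftrightarrow>
      expand (Label M (s i)) (\<lambda>\<chi>. v (FVar \<chi> i)) (\<lambda>\<chi>. v (FVar \<chi> (Suc i))) \<phi>"
    if "\<phi> \<in> cl \<psi>" "i \<le> k" for \<phi> i
    using v that peval_formula_constraints[OF assms(1) model]
    by (simp add: buchi_encoding_def s_def)
  have in_loop: "v (InLoop i) \<longleftrightarrow> (\<exists>j\<in>{1..i}. v (LVar j))" if "i \<le> k" for i
    using loop that
    by (intro iff_ex_atLeastAtMost_if_step[where P = "\<lambda>i. v (InLoop i)" and k = k])
      (auto simp: peval_loop_constraints[OF assms(1)])
  show ?thesis
  proof (cases "v LoopExists")
    case False
    obtain \<pi> where \<pi>: "initialised_path M \<pi>" "\<And>i. i \<le> k \<Longrightarrow> \<pi> i = s i"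
      using extend_to_path[OF assms(1) s0 trans] by blast
    have last_false: "\<not> v (FVar \<phi> (Suc k))" if "\<phi> \<in> cl \<psi>" for \<phi>
      using last that False unfolding peval_last_state_constraints by blast
    \<comment> \<open>The cut-off agrees with the valuation at \<open>k + 1\<close> on
      \<open>cl \<psi>\<close>, where the last-state constraints force false.\<close>
    define F where "F i \<phi> \<longleftrightarrow> i \<le> k \<and> v (FVar \<phi> i)" for i \<phi>
    have "models (Label M) \<pi> 0 \<psi>"
    proof (rule expand_sound)
      show "F 0 \<psi>" using \<psi> by (simp add: F_def)
      fix \<phi> i assume \<phi>: "\<phi> \<in> cl \<psi>"
      show "\<exists>j\<ge>i. accepts (F j) \<phi>"
        \<comment> \<open>This position lies beyond \<open>k\<close>, where \<open>F\<close> claims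
          nothing: the Until is not pending, and the second argument of the Release is
          false.\<close>
        by (rule exI[of _ "Suc (i + k)"]) (auto simp: accepts_def F_def split: ltl.split)
      assume F: "F i \<phi>"
      then have "expand (Label M (s i)) (\<lambda>\<chi>. v (FVar \<chi> i)) (\<lambda>\<chi>. v (FVar \<chi> (Suc i))) \<phi>"
        using formula[OF \<phi>, of i] unfolding F_def by blast
      moreover have "F i = (\<lambda>\<chi>. v (FVar \<chi> i))"
        using F unfolding F_def by blast
      moreover have "v (FVar \<chi> (Suc i)) = F (Suc i) \<chi>" if "\<chi> \<in> cl \<phi>" for \<chi>
        using F last_false[of \<chi>] that cl_subset[OF \<phi>]
        unfolding F_def by (metis Suc_leI le_neq_implies_less subsetD)
      moreover have "\<pi> i = s i"
        using \<pi>(2) F unfolding F_def by blast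
      ultimately show "expand (Label M (\<pi> i)) (F i) (F (Suc i)) \<phi>"
        using expand_cong[of \<phi> "\<lambda>\<chi>. v (FVar \<chi> (Suc i))" "F (Suc i)"] by metis
    qed
    with \<pi>(1) show ?thesis by blast
  next
    case True
    then have "v (InLoop k)"
      using loop by (simp add: peval_loop_constraints[OF assms(1)])
    then have ex: "\<exists>l. 1 \<le> l \<and> l \<le> k \<and> v (LVar l)"
      using in_loop[of k] by auto
    \<comment> \<open>With the least selected start, every position marked by \<open>InLoop\<close>
      lies at or after \<open>l\<close>; this places the acceptance witnesses inside the
      loop.\<close>
    define l where "l = (LEAST l. 1 \<le> l \<and> l \<le> k \<and> v (LVar l))"
    have l: "1 \<le> l" "l \<le> k" "v (LVar l)"
      using LeastI_ex[OF ex] by (auto simp: l_def)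
    have l_le: "l \<le> j" if "j \<le> k" "v (InLoop j)" for j
      using that in_loop[of j] Least_le[of "\<lambda>l. 1 \<le> l \<and> l \<le> k \<and> v (LVar l)"]
      unfolding l_def by (meson atLeastAtMost_iff order.trans)
    have s_loop: "s (l - 1) = s k"
      using loop l by (auto simp: peval_loop_constraints[OF assms(1)] s_def)
    have last_eq: "v (FVar \<phi> (Suc k)) = v (FVar \<phi> l)" if "\<phi> \<in> cl \<psi>" for \<phi>
      using last l that by (auto simp: peval_last_state_constraints)
    have accepts: "\<exists>j\<in>{l..k}. accepts (\<lambda>\<chi>. v (FVar \<chi> j)) \<phi>" if "\<phi> \<in> cl \<psi>" for \<phi>
    proof (cases "\<exists>a b. \<phi> = Until a b \<or> \<phi> = Release a b")
      case temporal: True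
      have "v (AccVar \<phi> k) \<longleftrightarrow>
          (\<exists>j\<in>{1..k}. v (InLoop j) \<and> accepts (\<lambda>\<chi>. v (FVar \<chi> j)) \<phi>)"
        using acc that temporal
        by (intro iff_ex_atLeastAtMost_if_step[where P = "\<lambda>i. v (AccVar \<phi> i)" and k = k])
          (auto simp only: peval_acceptance_constraints order_refl)
      moreover have "v (AccVar \<phi> k)"
        using acc that temporal True by (auto simp only: peval_acceptance_constraints)
      ultimately show ?thesis using l_le by fastforce
    next
      case False
      then have "accepts (\<lambda>\<chi>. v (FVar \<chi> l)) \<phi>"
        by (rule accepts_if_not_temporal)
      then show ?thesis using l(2) by auto
    qed
    define \<pi> where "\<pi> i = s (lasso_index k l i)" for i
    define F where "F i \<phi> \<longleftrightarrow> v (FVar \<phi> (lasso_index k l i))" for i \<phi>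
    have index_0: "lasso_index k l 0 = 0"
      using l by (simp add: lasso_index_def)
    \<comment> \<open>The closing step from \<open>k\<close> to \<open>l\<close> is the transition
      from \<open>l - 1\<close> to \<open>l\<close>, since \<open>s (l - 1) = s k\<close>.\<close>
    have "(\<pi> i, \<pi> (Suc i)) \<in> Trans M" for i
    proof (cases "lasso_index k l i = k")
      case True
      then show ?thesis
        using trans[of "l - 1"] l s_loop by (simp add: \<pi>_def lasso_index_Suc)
    next
      case False
      then show ?thesis
        using trans[of "lasso_index k l i"] lasso_index_le[of l k i] l
        by (simp add: \<pi>_def lasso_index_Suc)
    qed
    then have path: "initialised_path M \<pi>"
      using s0 by (simp add: initialised_path_def \<pi>_def index_0)
    have "models (Label M) \<pi> 0 \<psi>"
    proof (rule expand_sound)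
      show "F 0 \<psi>" using \<psi> by (simp add: F_def index_0)
      fix \<phi> i assume \<phi>: "\<phi> \<in> cl \<psi>"
      obtain j where "j \<in> {l..k}" "accepts (\<lambda>\<chi>. v (FVar \<chi> j)) \<phi>"
        using accepts[OF \<phi>] by blast
      moreover obtain m where "m \<ge> i" "lasso_index k l m = j"
        using ex_lasso_index_eq[of l j k i] calculation(1) by auto
      ultimately show "\<exists>j\<ge>i. accepts (F j) \<phi>"
        unfolding F_def by blast
      assume "F i \<phi>"
      then have "expand (Label M (\<pi> i)) (F i) (\<lambda>\<chi>. v (FVar \<chi> (Suc (lasso_index k l i)))) \<phi>"
        using formula[OF \<phi> lasso_index_le[OF l(2), of i]] unfolding F_def \<pi>_def by blast
      \<comment> \<open>Only the jump back from \<open>k\<close> differs from a plain successor;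
        there \<open>last_eq\<close> identifies the values at \<open>k + 1\<close> and
        \<open>l\<close>.\<close>
      moreover have "v (FVar \<chi> (Suc (lasso_index k l i))) = F (Suc i) \<chi>" if "\<chi> \<in> cl \<phi>" for \<chi>
        using last_eq[OF subsetD[OF cl_subset[OF \<phi>] that]] lasso_index_Suc[OF l(2), of i]
        unfolding F_def by (cases "lasso_index k l i = k") simp_all
      ultimately show "expand (Label M (\<pi> i)) (F i) (F (Suc i)) \<phi>"
        using expand_cong[of \<phi> "\<lambda>\<chi>. v (FVar \<chi> (Suc (lasso_index k l i)))" "F (Suc i)"] by metis
    qed
    with path show ?thesis by blast
  qed
qed

section \<open>From paths to valuations\<close>

text \<open>A single parameter \<open>l\<close> determines all loop variables, which makes the loop
  start unique. For \<open>l = Suc k\<close> none of the \<open>LVar\<close> and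
  \<open>InLoop\<close> variables up to \<open>k\<close> holds.\<close>

primrec path_valuation ::
  "'v set word \<Rightarrow> nat \<Rightarrow> nat \<Rightarrow> (nat \<Rightarrow> 'p ltl \<Rightarrow> bool) \<Rightarrow> ('v, 'p) enc_var \<Rightarrow> bool" where
  "path_valuation \<pi> k l F (StateVar x i) \<longleftrightarrow> x \<in> \<pi> i"
| "path_valuation \<pi> k l F (LVar i) \<longleftrightarrow> i = l"
| "path_valuation \<pi> k l F (InLoop i) \<longleftrightarrow> l \<le> i"
| "path_valuation \<pi> k l F LoopExists \<longleftrightarrow> l \<le> k"
| "path_valuation \<pi> k l F (FVar \<phi> i) \<longleftrightarrow> F i \<phi>"
| "path_valuation \<pi> k l F (AccVar \<phi> i) \<longleftrightarrow> (\<exists>j\<in>{l..i}. accepts (F j) \<phi>)"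

text \<open>\<open>l = k + 1\<close> encodes the absence of a loop.\<close>

lemma satisfiable_buchi_encodingI:
  assumes "kripke_structure M" "initialised_path M \<pi>"
    and l: "1 \<le> l" "l \<le> Suc k"
    and "F 0 \<psi>"
    and formula: "\<And>\<phi> i. \<phi> \<in> cl \<psi> \<Longrightarrow> i \<le> k \<Longrightarrow>
      F i \<phi> \<longleftrightarrow> expand (Label M (\<pi> i)) (F i) (F (Suc i)) \<phi>"
    and no_loop: "\<And>\<phi>. \<phi> \<in> cl \<psi> \<Longrightarrow> k < l \<Longrightarrow> \<not> F (Suc k) \<phi>"
    and loop_state: "l \<le> k \<Longrightarrow> \<pi> (l - 1) = \<pi> k"
    and loop_formula: "\<And>\<phi>. \<phi> \<in> cl \<psi> \<Longrightarrow> l \<le> k \<Longrightarrow> F (Suc k) \<phi> \<longleftrightarrow> F l \<phi>"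
    and accept: "\<And>\<phi>. \<phi> \<in> cl \<psi> \<Longrightarrow> l \<le> k \<Longrightarrow> \<exists>j\<in>{l..k}. accepts (F j) \<phi>"
  shows "satisfiable (buchi_encoding M \<psi> k)"
proof -
  define v where "v = path_valuation \<pi> k l F"
  have trans: "(\<pi> i, \<pi> (Suc i)) \<in> Trans M" for i
    using assms(2) by (simp add: initialised_path_def)
  have "\<pi> i \<in> States M" for i
    using trans kripke_structureD(6)[OF assms(1)] by blast
  then have decode: "decode M v i = \<pi> i" for i
    using kripke_structureD(7)[OF assms(1)] by (auto simp: decode_def v_def)
  have model: "peval v (model_constraints M k)"
    using assms(2) by (auto simp: peval_model_constraints[OF assms(1)] decode initialised_path_def)
  moreover have "peval v (loop_constraints M k)"
    using l loop_state
    by (auto simp: peval_loop_constraints[OF assms(1)] decode) (auto simp: v_def)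
  moreover have "peval v (last_state_constraints \<psi> k)"
    using no_loop loop_formula by (auto simp: peval_last_state_constraints v_def)
  moreover have "peval v (formula_constraints M \<psi> k)"
    using formula
    by (simp add: peval_formula_constraints[OF assms(1) model] decode) (simp add: v_def)
  moreover have "peval v (acceptance_constraints \<psi> k)"
  proof -
    \<comment> \<open>This is the recursion for \<open>AccVar\<close>, with \<open>l \<le> i\<close>
      as the value of \<open>InLoop i\<close>.\<close>
    have "(\<exists>j\<in>{l..i}. Q j) \<longleftrightarrow> (\<exists>j\<in>{l..i - 1}. Q j) \<or> l \<le> i \<and> Q i" if "i \<in> {1..k}" for i Q
      using that by (cases i) (auto simp: le_Suc_eq)
    then show ?thesis
      using l accept by (auto simp: peval_acceptance_constraints v_def)
  qed
  moreover have "v (FVar \<psi> 0)"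
    using \<open>F 0 \<psi>\<close> by (simp add: v_def)
  ultimately show ?thesis
    by (auto simp: satisfiable_def buchi_encoding_def)
qed

text \<open>The encoding inspects only positions up to \<open>k + 1\<close>. Agreement of the truth
  values at \<open>k + 1\<close> and \<open>l\<close> therefore stands in for periodicity, and the
  lemma serves arbitrary paths as well as genuine lassos.\<close>

lemma satisfiable_if_models_loop:
  assumes "kripke_structure M" "initialised_path M \<pi>" "models (Label M) \<pi> 0 \<psi>"
    and "1 \<le> l" "l \<le> k" "\<pi> (l - 1) = \<pi> k"
    and "\<And>\<phi>. \<phi> \<in> cl \<psi> \<Longrightarrow> models (Label M) \<pi> (Suc k) \<phi> \<longleftrightarrow> models (Label M) \<pi> l \<phi>"
    and "\<And>\<phi>. \<phi> \<in> cl \<psi> \<Longrightarrow> \<exists>j\<in>{l..k}. accepts (models (Label M) \<pi> j) \<phi>"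
  shows "satisfiable (buchi_encoding M \<psi> k)"
  by (rule satisfiable_buchi_encodingI[OF assms(1,2,4), of _ "models (Label M) \<pi>"])
    (use assms models_expand[of "Label M" \<pi>] in auto)

lemma ex_satisfiable_if_models:
  assumes "kripke_structure M" "initialised_path M \<pi>" "models (Label M) \<pi> 0 \<psi>"
  shows "\<exists>k. satisfiable (buchi_encoding M \<psi> k)"
proof -
  \<comment> \<open>The offset matches a loop start \<open>l = Suc m\<close>: states are compared at
    \<open>m\<close> and \<open>k\<close>, truth values at \<open>Suc m\<close> and
    \<open>Suc k\<close>.\<close>
  define \<sigma> where "\<sigma> i = (\<pi> i, {\<phi> \<in> cl \<psi>. models (Label M) \<pi> (Suc i) \<phi>})" for i
  have "\<pi> i \<in> States M" for i
    using assms(2) kripke_structureD(6)[OF assms(1)] by (auto simp: initialised_path_def)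
  then have "range \<sigma> \<subseteq> States M \<times> Pow (cl \<psi>)"
    by (auto simp: \<sigma>_def)
  then have "finite (range \<sigma>)"
    using kripke_structureD(2)[OF assms(1)] finite_cl[of \<psi>]
    by (meson finite_Pow_iff finite_SigmaI finite_subset)
  then obtain m where inf: "infinite {i. \<sigma> i = \<sigma> m}"
    using pigeonhole_infinite[of UNIV \<sigma>] by auto
  obtain w where w: "\<And>\<phi>. w \<phi> \<ge> Suc m \<and> accepts (models (Label M) \<pi> (w \<phi>)) \<phi>"
    using ex_accepts_models[of "Suc m" "Label M" \<pi>] by metis
  \<comment> \<open>Infinite recurrence of the value at \<open>m\<close> permits a \<open>k\<close>
    past \<open>m\<close> and past the acceptance position of every subformula.\<close>
  obtain k where k: "\<sigma> k = \<sigma> m" "k > Max (insert m (w ` cl \<psi>))"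
    using inf by (auto simp: infinite_nat_iff_unbounded)
  then have "k > m" and w_less: "\<And>\<phi>. \<phi> \<in> cl \<psi> \<Longrightarrow> w \<phi> < k"
    using finite_cl[of \<psi>] by auto
  have "satisfiable (buchi_encoding M \<psi> k)"
  proof (rule satisfiable_if_models_loop[OF assms, of "Suc m"])
    show "\<pi> (Suc m - 1) = \<pi> k"
      using k(1) by (simp add: \<sigma>_def)
    show "models (Label M) \<pi> (Suc k) \<phi> \<longleftrightarrow> models (Label M) \<pi> (Suc m) \<phi>" if "\<phi> \<in> cl \<psi>" for \<phi>
      using k(1) that by (auto simp: \<sigma>_def)
    show "\<exists>j\<in>{Suc m..k}. accepts (models (Label M) \<pi> j) \<phi>" if "\<phi> \<in> cl \<psi>" for \<phi>
      using w[of \<phi>] w_less[OF that] by force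
  qed (use \<open>k > m\<close> in auto)
  then show ?thesis by blast
qed

section \<open>Lassos and the bounded semantics\<close>

lemma kl_loop_eq_lasso_index:
  assumes "kl_loop \<pi> k l"
  shows "\<pi> i = \<pi> (lasso_index k l i)"
proof (cases "i < l")
  case False
  have l: "l \<le> k" and eq: "\<pi> = (\<pi> [0 \<rightarrow> l] \<frown> (\<pi> [l \<rightarrow> k + 1])\<^sup>\<omega>)"
    using assms by (auto simp: kl_loop_def)
  have "\<pi> i = (\<pi> [l \<rightarrow> k + 1])\<^sup>\<omega> (i - l)"
    using False by (subst eq) (simp add: conc_def subsequence_def)
  also have "\<dots> = \<pi> (l + (i - l) mod (Suc k - l))"
    using l mod_less_divisor[of "Suc k - l" "i - l", OF zero_less_diff[THEN iffD2]]
    by (simp add: iter_def subsequence_def less_diff_conv add.commute[of l] del: upt_Suc)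
  finally show ?thesis using False by (simp add: lasso_index_def)
qed (simp add: lasso_index_def)

text \<open>Both positions lie in the loop and are congruent modulo its period; this persists after
  \<open>n\<close> further steps.\<close>

lemma kl_loop_suffix_eq:
  assumes "kl_loop \<pi> k l" "l \<le> i"
  shows "suffix i \<pi> = suffix (lasso_index k l i) \<pi>"
proof
  fix n
  have "lasso_index k l (i + n) = lasso_index k l (lasso_index k l i + n)"
    using assms(2) by (simp add: lasso_index_def mod_add_left_eq)
  then show "suffix i \<pi> n = suffix (lasso_index k l i) \<pi> n"
    using kl_loop_eq_lasso_index[OF assms(1)] by (metis suffix_nth)
qed

text \<open>Truth values repeat with the loop, so an acceptance position found anywhere after
  \<open>l\<close> can be folded back into \<open>l..k\<close>.\<close>

lemma satisfiable_if_models_kl_loop: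
  assumes "kripke_structure M" "initialised_path M \<pi>" "models (Label M) \<pi> 0 \<psi>"
    and loop: "kl_loop \<pi> k l"
  shows "satisfiable (buchi_encoding M \<psi> k)"
proof (rule satisfiable_if_models_loop[OF assms(1-3)])
  show l: "1 \<le> l" "l \<le> k" "\<pi> (l - 1) = \<pi> k"
    using loop by (auto simp: kl_loop_def)
  have index: "models (Label M) \<pi> i \<phi> \<longleftrightarrow> models (Label M) \<pi> (lasso_index k l i) \<phi>"
    if "l \<le> i" for i \<phi>
    using models_eq_if_suffix_eq[OF kl_loop_suffix_eq[OF loop that]] .
  \<comment> \<open>\<open>Suc k\<close> is exactly one period after \<open>l\<close>.\<close>
  show "models (Label M) \<pi> (Suc k) \<phi> \<longleftrightarrow> models (Label M) \<pi> l \<phi>" for \<phi>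
    using index[of "Suc k"] l by (simp add: lasso_index_def)
  fix \<phi>
  obtain j where j: "j \<ge> l" "accepts (models (Label M) \<pi> j) \<phi>"
    using ex_accepts_models by blast
  have "accepts (models (Label M) \<pi> (lasso_index k l j)) \<phi>"
    using j(2) ext[of "models (Label M) \<pi> j", OF index[OF j(1)]] by simp
  moreover have "lasso_index k l j \<in> {l..k}"
    using j(1) lasso_index_le[OF l(2), of j] by (simp add: lasso_index_def)
  ultimately show "\<exists>j\<in>{l..k}. accepts (models (Label M) \<pi> j) \<phi>" by blast
qed

text \<open>\<open>models_nl\<close> by itself may hold at \<open>k + 1\<close>, for instance of a
  proposition. The conjunct \<open>i \<le> k\<close> makes all formula variables false there and
  yields exactly the next-position values of \<open>models_nl_expand\<close>.\<close>

lemma satisfiable_if_models_nl: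
  assumes "kripke_structure M" "initialised_path M \<pi>" "models_nl (Label M) k \<pi> 0 \<psi>"
  shows "satisfiable (buchi_encoding M \<psi> k)"
proof (rule satisfiable_buchi_encodingI[OF assms(1,2),
      where F = "\<lambda>i \<phi>. i \<le> k \<and> models_nl (Label M) k \<pi> i \<phi>" and l = "Suc k"])
  show "i \<le> k \<and> models_nl (Label M) k \<pi> i \<phi> \<longleftrightarrow>
      expand (Label M (\<pi> i)) (\<lambda>\<phi>. i \<le> k \<and> models_nl (Label M) k \<pi> i \<phi>)
        (\<lambda>\<phi>. Suc i \<le> k \<and> models_nl (Label M) k \<pi> (Suc i) \<phi>) \<phi>"
    if "i \<le> k" for i \<phi>
    using models_nl_expand[OF that, of "Label M" \<pi> \<phi>] that by simp
qed (use assms(3) in auto)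

theorem theorem3p3:
  fixes M :: "('v, 'p) kripke" and \<psi> :: "'p ltl"
  assumes "kripke_structure M"
  shows "((\<exists>\<pi>. initialised_path M \<pi> \<and> models (Label M) \<pi> 0 \<psi>) \<longleftrightarrow>
            (\<exists>k. satisfiable (buchi_encoding M \<psi> k))) \<and>
         (\<forall>\<pi> k. initialised_path M \<pi> \<and> models_bounded (Label M) k \<pi> \<psi> \<longrightarrow>
            satisfiable (buchi_encoding M \<psi> k))"
  using ex_path_if_satisfiable[OF assms] ex_satisfiable_if_models[OF assms]
    satisfiable_if_models_kl_loop[OF assms] satisfiable_if_models_nl[OF assms]
  unfolding models_bounded_def by blast

end
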